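(* Let $H$ be a real Hilbert space and let $F=f+g$, where $f:H\to\mathbb{R}$ is $\mu$-strongly convex and $L$-smooth with $L\ge\mu>0$, and $g:H\to\mathbb{R}\cup\{\infty\}$ is convex, proper and lower-semicontinuous. Assume $\operatorname{argmin}(F)\neq\emptyset$, let $x^*\in\operatorname{argmin}(F)$ and $F^*=F(x^* )$. Let $(x_k),(y_k),(z_k)$ be generated by (M-APM) with $s=\frac{1}{2L}$ and $\gamma=1$ from initial points $x_0,y_0\in H$. Then for every $k\ge2$, $$F(y_k)-F^*\le\frac{L\|x_0-x^*\|^2}{t_k(t_k-1)}(1+\rho)^{-k+2},\quad\text{with}\quad\rho=\frac{\mu}{4L+5\mu}.$$
   Context: $L$-smooth means $f$ is differentiable with $L$-Lipschitz gradient. $\mu$-strongly convex means $f-\frac{\mu}{2}\|\cdot\|^2$ is convex. $\operatorname{prox}_{sg}(v)=\operatorname{arg\,min}_{u\in H}\{g(u)+\frac{1}{2s}\|u-v\|^2\}$. The sequence $(t_k)_{k\ge0}$ is $t_0=1$, $t_k=\frac{1+\sqrt{1+4t_{k-1}^2}}{2}$ for $k\ge1$. Algorithm (M-APM) with parameters $s,\gamma$: given $x_0,y_0\in H$, for $k\ge0$, $$z_k=\operatorname{prox}_{sg}(x_k-s\nabla f(x_k)),\qquad y_{k+1}=\begin{cases}z_k,&\text{if }F(z_k)\le F(y_k),\\ y_k,&\text{otherwise},\end{cases}$$ $$x_{k+1}=y_{k+1}+\frac{t_k-1}{t_{k+1}}(y_{k+1}-y_k)+\frac{t_k}{t_{k+1}}(z_k-y_{k+1})+\frac{t_k(\gamma-1)}{t_{k+1}}(z_k-x_k).$$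 *)

theory Defs
  imports "HOL-Analysis.Analysis"
begin

text \<open>
  A real Hilbert space is a type of sort \<open>{real_inner, complete_space}\<close>. By the Riesz
  representation theorem every (Frechet) differentiable function on such a space has a gradient,
  so the description below always denotes when \<open>f differentiable (at x)\<close>.
\<close>

definition gradient :: "('a::{real_inner, complete_space} \<Rightarrow> real) \<Rightarrow> 'a \<Rightarrow> 'a" where
  "gradient f x = (THE D. GDERIV f x :> D)"

definition smooth_fun :: "real \<Rightarrow> ('a::{real_inner, complete_space} \<Rightarrow> real) \<Rightarrow> bool" where
  "smooth_fun L f \<longleftrightarrow> (\<forall>x. f differentiable (at x)) \<and> L-lipschitz_on UNIV (gradient f)"

definition strongly_convex_fun :: "real \<Rightarrow> ('a::{real_inner, complete_space} \<Rightarrow> real) \<Rightarrow> bool" where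
  "strongly_convex_fun \<mu> f \<longleftrightarrow> convex_on UNIV (\<lambda>x. f x - \<mu> / 2 * (norm x)\<^sup>2)"

text \<open>
  Functions with values in \<open>\<real> \<union> {\<infinity>}\<close> are functions into \<^typ>\<open>ereal\<close>
  that avoid \<open>-\<infinity>\<close>; that requirement is part of properness.
\<close>

definition proper_fun :: "('a::{real_inner, complete_space} \<Rightarrow> ereal) \<Rightarrow> bool" where
  "proper_fun g \<longleftrightarrow> (\<forall>x. g x \<noteq> -\<infinity>) \<and> (\<exists>x. g x \<noteq> \<infinity>)"

text \<open>
  Weights \<open>0\<close> and \<open>1\<close> are harmless, since \<open>0 * \<infinity> = 0\<close> in \<^typ>\<open>ereal\<close>.
\<close>

definition convex_fun :: "('a::{real_inner, complete_space} \<Rightarrow> ereal) \<Rightarrow> bool" where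
  "convex_fun g \<longleftrightarrow>
    (\<forall>x y. \<forall>u\<ge>0. \<forall>v\<ge>0. u + v = 1 \<longrightarrow>
      g (u *\<^sub>R x + v *\<^sub>R y) \<le> ereal u * g x + ereal v * g y)"

text \<open>
  \<^term>\<open>at x\<close> is the punctured neighbourhood filter, which gives the same notion of
  lower semicontinuity as the unpunctured one.
\<close>

definition lsc_fun :: "('a::{real_inner, complete_space} \<Rightarrow> ereal) \<Rightarrow> bool" where
  "lsc_fun g \<longleftrightarrow> (\<forall>x. g x \<le> Liminf (at x) g)"

definition composite ::
    "('a::{real_inner, complete_space} \<Rightarrow> real) \<Rightarrow> ('a \<Rightarrow> ereal) \<Rightarrow> 'a \<Rightarrow> ereal" where
  "composite f g u = ereal (f u) + g u"

definition prox ::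
    "real \<Rightarrow> ('a::{real_inner, complete_space} \<Rightarrow> ereal) \<Rightarrow> 'a \<Rightarrow> 'a" where
  "prox s g v = (ARG_MIN (\<lambda>u. g u + ereal (1 / (2 * s) * (norm (u - v))\<^sup>2)) u. True)"

fun tseq :: "nat \<Rightarrow> real" where
  "tseq 0 = 1"
| "tseq (Suc k) = (1 + sqrt (1 + 4 * (tseq k)\<^sup>2)) / 2"

text \<open>
  The sequences \<open>x\<close>, \<open>y\<close>, \<open>z\<close> are generated by (M-APM) with parameters
  \<open>s\<close>, \<open>\<gamma>\<close> from the initial points \<open>x 0\<close>, \<open>y 0\<close>, which are unconstrained.
\<close>

definition m_apm ::
    "real \<Rightarrow> real \<Rightarrow> ('a::{real_inner, complete_space} \<Rightarrow> real) \<Rightarrow> ('a \<Rightarrow> ereal) \<Rightarrow>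
     (nat \<Rightarrow> 'a) \<Rightarrow> (nat \<Rightarrow> 'a) \<Rightarrow> (nat \<Rightarrow> 'a) \<Rightarrow> bool" where
  "m_apm s \<gamma> f g x y z \<longleftrightarrow>
    (\<forall>k. z k = prox s g (x k - s *\<^sub>R gradient f (x k)) \<and>
         y (Suc k) = (if composite f g (z k) \<le> composite f g (y k) then z k else y k) \<and>
         x (Suc k) = y (Suc k)
           + ((tseq k - 1) / tseq (Suc k)) *\<^sub>R (y (Suc k) - y k)
           + (tseq k / tseq (Suc k)) *\<^sub>R (z k - y (Suc k))
           + (tseq k * (\<gamma> - 1) / tseq (Suc k)) *\<^sub>R (z k - x k))"

end

theory Submission
  imports Defs
begin

text \<open>
  The Lyapunov function is
  \<open>E\<^sub>k = t\<^sub>k (t\<^sub>k - 1) (F(y\<^sub>k) - F\<^sup>*) + L \<parallel>u\<^sub>k - x\<^sup>*\<parallel>\<^sup>2\<close> with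
  \<open>u\<^sub>k = t\<^sub>k x\<^sub>k - (t\<^sub>k - 1) y\<^sub>k\<close>; its value at \<open>k = 0\<close> is \<open>L \<parallel>x\<^sub>0 - x\<^sup>*\<parallel>\<^sup>2\<close>.
  Let \<open>G = 2L (x\<^sub>k - z\<^sub>k)\<close> be the gradient mapping. Because the step \<open>1/(2L)\<close> is shorter than
  \<open>1/L\<close>, the usual FISTA estimate, taken at \<open>y\<^sub>k\<close> and \<open>x\<^sup>*\<close>, leaves the surplus
  \<open>t\<^sup>2/(8L) \<parallel>G\<parallel>\<^sup>2 + \<mu>/2 \<parallel>u\<^sub>k - x\<^sup>*\<parallel>\<^sup>2\<close>, the second term being what convexity of
  the square makes of the strong convexity terms at \<open>x\<^sub>k - x\<^sup>*\<close> and \<open>x\<^sub>k - y\<^sub>k\<close>. Since also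
  \<open>F(z\<^sub>k) - F\<^sup>* \<le> (1/(2\<mu>) - 3/(8L)) \<parallel>G\<parallel>\<^sup>2\<close>, this surplus dominates \<open>\<rho> E\<^bsub>k+1\<^esub>\<close>, so that
  \<open>(1 + \<rho>) E\<^bsub>k+1\<^esub> \<le> E\<^sub>k\<close>.
\<close>

section \<open>Existence of proximal points\<close>

text \<open>Strong convexity of the quadratic makes a minimizing sequence Cauchy, and lower
  semicontinuity makes its limit a minimizer. The bound \<open>lower\<close> keeps the infimum
  finite; each use of the lemma supplies its own \<open>A\<close> and \<open>B\<close>.\<close>

lemma proximal_minimizer_exists:
  fixes g :: "'a::{real_inner, complete_space} \<Rightarrow> ereal"
  assumes conv: "convex_fun g" and lsc: "lsc_fun g" and s: "0 < s"
    and lower: "\<And>u. ereal (- A - B * norm u) \<le> g u"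
    and fin: "g u0 \<noteq> \<infinity>"
  shows "\<exists>w. is_arg_min (\<lambda>u. g u + ereal (1 / (2 * s) * (norm (u - v))\<^sup>2)) (\<lambda>_. True) w"
proof -
  define \<phi> where "\<phi> u = g u + ereal (1 / (2 * s) * (norm (u - v))\<^sup>2)" for u
  define m where "m = (INF u. \<phi> u)"
  have g_not_minf: "g u \<noteq> -\<infinity>" for u
    using lower[of u] by auto
  have lower\<phi>: "ereal (- A - \<bar>B\<bar> * norm v - s * B\<^sup>2 / 2) \<le> \<phi> u" for u
  proof -
    have n: "norm u \<le> norm v + norm (u - v)"
      by (metis add_diff_cancel_left' diff_add_cancel norm_triangle_ineq add.commute)
    have "B * norm u \<le> \<bar>B\<bar> * norm v + \<bar>B\<bar> * norm (u - v)"
      by (smt (verit, best) n distrib_left mult_left_mono mult_right_mono norm_ge_zero)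
    \<comment> \<open>Young's inequality with weight \<open>s\<close>: the quadratic absorbs the
      linear decrease that \<open>lower\<close> permits.\<close>
    moreover have "\<bar>B\<bar> * norm (u - v) \<le> s * B\<^sup>2 / 2 + 1 / (2 * s) * (norm (u - v))\<^sup>2"
    proof -
      have "0 \<le> (s * \<bar>B\<bar> - norm (u - v))\<^sup>2 / (2 * s)"
        using s by simp
      also have "\<dots> = s * B\<^sup>2 / 2 + 1 / (2 * s) * (norm (u - v))\<^sup>2 - \<bar>B\<bar> * norm (u - v)"
        using s by (simp add: power2_eq_square field_simps)
      finally show ?thesis by simp
    qed
    ultimately have "- A - \<bar>B\<bar> * norm v - s * B\<^sup>2 / 2
        \<le> (- A - B * norm u) + 1 / (2 * s) * (norm (u - v))\<^sup>2"
      by linarith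
    then have "ereal (- A - \<bar>B\<bar> * norm v - s * B\<^sup>2 / 2)
        \<le> ereal (- A - B * norm u) + ereal (1 / (2 * s) * (norm (u - v))\<^sup>2)"
      by simp
    also have "\<dots> \<le> \<phi> u"
      unfolding \<phi>_def by (intro add_right_mono lower)
    finally show ?thesis .
  qed
  have "ereal (- A - \<bar>B\<bar> * norm v - s * B\<^sup>2 / 2) \<le> m"
    unfolding m_def by (intro INF_greatest lower\<phi>)
  then have m1: "m \<noteq> -\<infinity>" by auto
  have "m \<le> \<phi> u0" unfolding m_def by (intro INF_lower) simp
  moreover have "\<phi> u0 \<noteq> \<infinity>" using fin by (simp add: \<phi>_def)
  ultimately have m2: "m \<noteq> \<infinity>" by auto
  obtain mr where mr: "m = ereal mr" using m1 m2 by (cases m) auto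
  have m_le: "ereal mr \<le> \<phi> u" for u
    unfolding mr[symmetric] m_def by (intro INF_lower) simp
  have "\<exists>u. \<phi> u < ereal (mr + e)" if "e > 0" for e
  proof -
    have "(INF u. \<phi> u) < ereal (mr + e)"
      using mr that by (simp add: m_def)
    then show ?thesis by (simp add: INF_less_iff)
  qed
  then have "\<exists>w. \<forall>n. \<phi> (w n) < ereal (mr + 1 / real (Suc n))"
    by (intro choice) simp
  then obtain w where w: "\<And>n. \<phi> (w n) < ereal (mr + 1 / real (Suc n))" by blast
  define r where "r n = real_of_ereal (g (w n))" for n
  have r: "g (w n) = ereal (r n)" for n
  proof -
    have "g (w n) \<noteq> \<infinity>" using w[of n] by (auto simp: \<phi>_def)
    then show ?thesis using g_not_minf[of "w n"] by (cases "g (w n)") (auto simp: r_def)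
  qed
  have wr: "r n + 1 / (2 * s) * (norm (w n - v))\<^sup>2 < mr + 1 / real (Suc n)" for n
    using w[of n] by (simp add: \<phi>_def r)
  \<comment> \<open>Compare with the midpoint \<open>h\<close>: by the parallelogram law its
    quadratic term lies |w i - w j|^2 / (8s) below the average of the two, while its value is still
    at least \<open>mr\<close>.\<close>
  have dist: "(norm (w i - w j))\<^sup>2 \<le> 4 * s * (1 / real (Suc i) + 1 / real (Suc j))" for i j
  proof -
    define h where "h = (1/2) *\<^sub>R w i + (1/2) *\<^sub>R w j"
    have "g h \<le> ereal (1/2) * g (w i) + ereal (1/2) * g (w j)"
      using conv unfolding convex_fun_def h_def by (metis field_sum_of_halves half_gt_zero_iff less_imp_le zero_less_one)
    then have "g h \<le> ereal (r i / 2 + r j / 2)" by (simp add: r)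
    then have "g h + ereal (1 / (2 * s) * (norm (h - v))\<^sup>2)
       \<le> ereal (r i / 2 + r j / 2) + ereal (1 / (2 * s) * (norm (h - v))\<^sup>2)"
      by (intro add_right_mono)
    then have 1: "mr \<le> r i / 2 + r j / 2 + 1 / (2 * s) * (norm (h - v))\<^sup>2"
      using m_le[of h] order_trans unfolding \<phi>_def by fastforce
    have 2: "(norm (h - v))\<^sup>2 =
       (norm (w i - v))\<^sup>2 / 2 + (norm (w j - v))\<^sup>2 / 2 - (norm (w i - w j))\<^sup>2 / 4"
      unfolding h_def power2_norm_eq_inner
      by (simp add: inner_simps inner_commute field_simps)
    have "1 / (2 * s) * (X / 2 + Y / 2 - Z / 4) = (1 / (2 * s) * X) / 2 + (1 / (2 * s) * Y) / 2 - Z / (8 * s)"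
      for X Y Z using s by (simp add: field_simps)
    note 1[unfolded 2 this]
    moreover have "c \<le> (p + q) / 2"
      if "mr \<le> a / 2 + b / 2 + (a' / 2 + b' / 2 - c)" "a + a' < mr + p" "b + b' < mr + q"
      for a a' b b' c p q :: real using that by argo
    ultimately have "(norm (w i - w j))\<^sup>2 / (8 * s) \<le> (1 / real (Suc i) + 1 / real (Suc j)) / 2"
      using wr[of i] wr[of j] by blast
    then show ?thesis using s by (simp add: field_simps del: of_nat_Suc)
  qed
  have "Cauchy w"
  proof (rule metric_CauchyI)
    fix e :: real assume e: "0 < e"
    obtain N where N: "8 * s / e\<^sup>2 < real N" using reals_Archimedean2 by blast
    show "\<exists>M. \<forall>m\<ge>M. \<forall>n\<ge>M. dist (w m) (w n) < e"
    proof (intro exI[of _ N] allI impI)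
      fix i j assume ij: "N \<le> i" "N \<le> j"
      have "8 * s < e\<^sup>2 * real (Suc N)" using N e by (simp add: field_simps add_strict_increasing)
      then have "8 * s / real (Suc N) < e\<^sup>2" by (simp add: field_simps)
      moreover have "1 / real (Suc i) \<le> 1 / real (Suc N)" "1 / real (Suc j) \<le> 1 / real (Suc N)"
        using ij by (auto intro!: divide_left_mono)
      then have "4 * s * (1 / real (Suc i) + 1 / real (Suc j)) \<le> 4 * s * (2 / real (Suc N))"
        using s by (intro mult_left_mono) auto
      ultimately have "(norm (w i - w j))\<^sup>2 < e\<^sup>2" using dist[of i j] by simp
      then show "dist (w i) (w j) < e"
        using e by (simp add: dist_norm power2_less_imp_less)
    qed
  qed
  then obtain l where l: "w \<longlonglongrightarrow> l" using Cauchy_convergent convergentD by blast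
  define Q where "Q = 1 / (2 * s) * (norm (l - v))\<^sup>2"
  \<comment> \<open>Testing real \<open>c\<close> below \<open>g l\<close> covers the possibility
    that \<open>g l\<close> is infinite.\<close>
  have below: "c + Q \<le> mr" if c: "ereal c < g l" for c
  proof -
    have "\<forall>\<^sub>F u in at l. ereal c < g u"
      using lsc c unfolding lsc_fun_def le_Liminf_iff by blast
    \<comment> \<open>The sequence may hit its limit, so the punctured filter must be completed by
      the point \<open>l\<close>, where the inequality is the choice of \<open>c\<close>.\<close>
    then have "\<forall>\<^sub>F u in nhds l. ereal c < g u"
      using c unfolding eventually_at_filter by (auto elim: eventually_mono)
    then have "\<forall>\<^sub>F n in sequentially. ereal c < g (w n)"
      using l by (rule eventually_compose_filterlim)
    then have "\<forall>\<^sub>F n in sequentially. c + 1 / (2 * s) * (norm (w n - v))\<^sup>2 \<le> mr + 1 / real (Suc n)"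
    proof (rule eventually_mono)
      fix n assume "ereal c < g (w n)"
      then show "c + 1 / (2 * s) * (norm (w n - v))\<^sup>2 \<le> mr + 1 / real (Suc n)"
        using wr[of n] by (simp add: r)
    qed
    note ev = this
    have lim1: "(\<lambda>n. c + 1 / (2 * s) * (norm (w n - v))\<^sup>2) \<longlonglongrightarrow> c + Q"
      unfolding Q_def by (intro tendsto_intros l)
    have "(\<lambda>n. mr + 1 / real (Suc n)) \<longlonglongrightarrow> mr + 0"
      using tendsto_add[OF tendsto_const LIMSEQ_inverse_real_of_nat, of mr] by (simp only: inverse_eq_divide)
    then have "c + Q \<le> mr + 0"
      by (rule tendsto_le[OF trivial_limit_sequentially _ lim1 ev])
    then show ?thesis by simp
  qed
  have "g l \<le> ereal (mr - Q)"
  proof (rule ccontr)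
    assume "\<not> g l \<le> ereal (mr - Q)"
    then obtain c where "ereal (mr - Q) < ereal c" "ereal c < g l"
      using ereal_dense2[of "ereal (mr - Q)" "g l"] by (auto simp: not_le)
    then show False using below[of c] by simp
  qed
  then have "\<phi> l \<le> ereal (mr - Q) + ereal Q"
    unfolding \<phi>_def Q_def by (rule add_right_mono)
  then have "\<phi> l \<le> ereal mr" by simp
  then have "\<not> \<phi> u < \<phi> l" for u
    using m_le[of u] by (meson leD order_trans)
  then show ?thesis by (auto simp: is_arg_min_def \<phi>_def[abs_def] intro!: exI[of _ l])
qed

section \<open>First-order optimality conditions\<close>

text \<open>In other words, -p is a subgradient of \<open>g\<close> at \<open>w\<close>. Moving a
  fraction \<open>t\<close> from \<open>w\<close> towards \<open>u\<close> changes the linear parts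
  by order \<open>t\<close> and the quadratic remainder by order t^2, so dividing by
  \<open>t\<close> and letting it tend to 0 removes the remainder. A quadratic upper model of
  \<open>\<phi>\<close> suffices, which covers both the proximal quadratic and \<open>f\<close>
  itself.\<close>

lemma minimizer_tangent_bound:
  fixes g :: "'a::{real_inner, complete_space} \<Rightarrow> ereal"
  assumes conv: "convex_fun g" and gz: "g w = ereal r"
    and \<phi>: "\<And>u. \<phi> u \<le> \<phi> w + p \<bullet> (u - w) + C * (norm (u - w))\<^sup>2"
    and min: "\<And>u. g w + ereal (\<phi> w) \<le> g u + ereal (\<phi> u)"
  shows "ereal (r - p \<bullet> (u - w)) \<le> g u"
proof (cases "g u")
  case (real q)
  have "r - p \<bullet> (u - w) - q \<le> t * (C * (norm (u - w))\<^sup>2)" if t: "0 < t" "t < 1" for t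
  proof -
    define h where "h = (1 - t) *\<^sub>R w + t *\<^sub>R u"
    have h: "h - w = t *\<^sub>R (u - w)" by (simp add: h_def algebra_simps)
    have "g h \<le> ereal (1 - t) * g w + ereal t * g u"
      using conv t unfolding convex_fun_def h_def by auto
    then have "g h \<le> ereal ((1 - t) * r + t * q)" by (simp add: gz real)
    then have "g h + ereal (\<phi> h) \<le> ereal ((1 - t) * r + t * q) + ereal (\<phi> h)"
      by (rule add_right_mono)
    with min[of h] have "r + \<phi> w \<le> (1 - t) * r + t * q + \<phi> h"
      unfolding gz using order_trans by fastforce
    moreover have "\<phi> h \<le> \<phi> w + t * (p \<bullet> (u - w)) + t * (t * (C * (norm (u - w))\<^sup>2))"
      using \<phi>[of h] unfolding h by (simp add: power_mult_distrib power2_eq_square[of t] mult.assoc mult.left_commute)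
    ultimately have "0 \<le> t * (q - r + p \<bullet> (u - w) + t * (C * (norm (u - w))\<^sup>2))"
      by (simp add: algebra_simps)
    then show ?thesis using t by (simp add: zero_le_mult_iff)
  qed
  moreover have "((\<lambda>t. t * (C * (norm (u - w))\<^sup>2)) \<longlongrightarrow> 0) (at_right 0)"
    by (auto intro!: tendsto_eq_intros)
  ultimately have "r - p \<bullet> (u - w) - q \<le> 0"
    by (intro tendsto_lowerbound[where F="at_right (0::real)"])
       (auto simp: eventually_at_right_field intro!: exI[of _ 1])
  then show ?thesis by (simp add: real)
next
  case PInf
  then show ?thesis by simp
next
  case MInf
  with min[of u] gz show ?thesis by simp
qed

lemma prox_tangent_bound:
  fixes g :: "'a::{real_inner, complete_space} \<Rightarrow> ereal"
  assumes conv: "convex_fun g" and gw: "g w = ereal r" and s: "0 < s"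
    and w: "is_arg_min (\<lambda>u. g u + ereal (1 / (2 * s) * (norm (u - v))\<^sup>2)) (\<lambda>_. True) w"
  shows "ereal (r + ((v - w) /\<^sub>R s) \<bullet> (u - w)) \<le> g u"
proof -
  have "ereal (r - ((w - v) /\<^sub>R s) \<bullet> (u - w)) \<le> g u"
  proof (rule minimizer_tangent_bound[OF conv gw])
    show "1 / (2 * s) * (norm (u - v))\<^sup>2 \<le> 1 / (2 * s) * (norm (w - v))\<^sup>2
        + ((w - v) /\<^sub>R s) \<bullet> (u - w) + 1 / (2 * s) * (norm (u - w))\<^sup>2" for u
      unfolding power2_norm_eq_inner using s
      by (simp add: inner_simps inner_commute field_simps)
    show "g w + ereal (1 / (2 * s) * (norm (w - v))\<^sup>2) \<le> g u + ereal (1 / (2 * s) * (norm (u - v))\<^sup>2)" for u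
      using w by (simp add: is_arg_min_def not_less)
  qed
  then show ?thesis by (simp add: inner_simps algebra_simps)
qed

section \<open>Quadratic bounds for smooth and strongly convex functions\<close>

text \<open>Subtracting the quadratic model along the segment leaves a function \<open>h\<close>
  whose derivative is nonpositive, by Cauchy-Schwarz and the Lipschitz bound.\<close>

lemma descent_lemma:
  fixes f :: "'a::real_inner \<Rightarrow> real"
  assumes grad: "\<And>x. GDERIV f x :> G x" and lip: "L-lipschitz_on UNIV G"
  shows "f u \<le> f x + G x \<bullet> (u - x) + L / 2 * (norm (u - x))\<^sup>2"
proof -
  define d where "d = u - x"
  define h where "h t = f (x + t *\<^sub>R d) - t * (G x \<bullet> d) - L / 2 * t\<^sup>2 * (norm d)\<^sup>2" for t
  have "h 1 \<le> h 0"
  proof (rule DERIV_nonpos_imp_nonincreasing[where f = h])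
    fix t :: real assume t: "0 \<le> t" "t \<le> 1"
    have "(f has_derivative (\<lambda>y. y \<bullet> G (x + t *\<^sub>R d))) (at (x + t *\<^sub>R d))"
      using grad unfolding gderiv_def .
    then have "((\<lambda>t. f (x + t *\<^sub>R d)) has_derivative (\<lambda>y. (y *\<^sub>R d) \<bullet> G (x + t *\<^sub>R d))) (at t)"
      by (rule has_derivative_compose[rotated]) (auto intro!: derivative_eq_intros)
    then have 1: "((\<lambda>t. f (x + t *\<^sub>R d)) has_real_derivative d \<bullet> G (x + t *\<^sub>R d)) (at t)"
      unfolding has_field_derivative_def by (rule has_derivative_eq_rhs) (simp add: fun_eq_iff)
    have 2: "(h has_real_derivative d \<bullet> G (x + t *\<^sub>R d) - G x \<bullet> d - L * t * (norm d)\<^sup>2) (at t)"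
      unfolding h_def by (auto intro!: derivative_eq_intros 1 simp: algebra_simps)
    have "dist (G (x + t *\<^sub>R d)) (G x) \<le> L * dist (x + t *\<^sub>R d) x"
      using lip by (rule lipschitz_onD) auto
    then have "norm (G (x + t *\<^sub>R d) - G x) \<le> L * t * norm d"
      using t by (simp add: dist_norm)
    then have "norm d * norm (G (x + t *\<^sub>R d) - G x) \<le> norm d * (L * t * norm d)"
      by (intro mult_left_mono) auto
    moreover have "d \<bullet> (G (x + t *\<^sub>R d) - G x) \<le> norm d * norm (G (x + t *\<^sub>R d) - G x)"
      by (rule norm_cauchy_schwarz)
    ultimately have "d \<bullet> G (x + t *\<^sub>R d) - G x \<bullet> d - L * t * (norm d)\<^sup>2 \<le> 0"
      by (simp add: inner_diff_right inner_commute power2_eq_square algebra_simps)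
    with 2 show "\<exists>y. (h has_real_derivative y) (at t) \<and> y \<le> 0" by blast
  qed simp
  then show ?thesis by (simp add: h_def d_def)
qed

text \<open>The one-dimensional tangent inequality is applied to f - \<mu>/2 |.|^2 along the line
  from \<open>x\<close> to \<open>u\<close>. Expanding the square makes the terms in
  \<open>x\<close> cancel and leaves \<mu>/2 |u - x|^2.\<close>

lemma strongly_convex_tangent:
  fixes f :: "'a::{real_inner, complete_space} \<Rightarrow> real"
  assumes grad: "GDERIV f x :> G" and conv: "strongly_convex_fun \<mu> f"
  shows "f x + G \<bullet> (u - x) + \<mu> / 2 * (norm (u - x))\<^sup>2 \<le> f u"
proof -
  define d where "d = u - x"
  define q where "q y = f y - \<mu> / 2 * (norm y)\<^sup>2" for y
  have q: "convex_on UNIV q"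
    using conv unfolding strongly_convex_fun_def q_def .
  define h where "h t = q (x + t *\<^sub>R d)" for t
  have "convex_on UNIV h"
  proof (rule convex_onI)
    fix t a b :: real assume t: "0 < t" "t < 1"
    have "x + ((1 - t) *\<^sub>R a + t *\<^sub>R b) *\<^sub>R d = (1 - t) *\<^sub>R (x + a *\<^sub>R d) + t *\<^sub>R (x + b *\<^sub>R d)"
      by (simp add: algebra_simps)
    then show "h ((1 - t) *\<^sub>R a + t *\<^sub>R b) \<le> (1 - t) * h a + t * h b"
      using convex_onD[OF q, of t "x + a *\<^sub>R d" "x + b *\<^sub>R d"] t by (simp add: h_def)
  qed simp
  have "(f has_derivative (\<lambda>y. y \<bullet> G)) (at (x + 0 *\<^sub>R d))"
    using grad unfolding gderiv_def by simp
  then have "((\<lambda>t. f (x + t *\<^sub>R d)) has_derivative (\<lambda>y. (y *\<^sub>R d) \<bullet> G)) (at 0)"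
    by (rule has_derivative_compose[rotated]) (auto intro!: derivative_eq_intros)
  then have 1: "((\<lambda>t. f (x + t *\<^sub>R d)) has_real_derivative d \<bullet> G) (at 0)"
    unfolding has_field_derivative_def by (rule has_derivative_eq_rhs) (simp add: fun_eq_iff)
  have h: "h = (\<lambda>t. f (x + t *\<^sub>R d) - \<mu> / 2 * (x \<bullet> x + t * (2 * (x \<bullet> d)) + t\<^sup>2 * (d \<bullet> d)))"
    unfolding h_def q_def power2_norm_eq_inner
    by (rule ext) (simp add: inner_simps inner_commute power2_eq_square algebra_simps)
  have "(h has_real_derivative d \<bullet> G - \<mu> * (x \<bullet> d)) (at 0)"
    unfolding h by (auto intro!: derivative_eq_intros 1 simp: algebra_simps)
  then have "(d \<bullet> G - \<mu> * (x \<bullet> d)) * (1 - 0) \<le> h 1 - h 0"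
    by (intro convex_on_imp_above_tangent[OF \<open>convex_on UNIV h\<close>]) auto
  then have "d \<bullet> G \<le> f (x + d) - f x - \<mu> / 2 * (d \<bullet> d)"
    unfolding h by (simp add: algebra_simps)
  then show ?thesis
    by (simp add: d_def power2_norm_eq_inner inner_commute)
qed

section \<open>Contraction of the Lyapunov function in one step\<close>

text \<open>This is pure algebra on real values: \<open>w\<close> plays the minimizer,
  \<open>F'\<close> the next value of F(y). Hypothesis \<open>y\<close> carries the factor t - 1 so
  that it is trivial for t = 1, where F(y) may be infinite.\<close>

lemma accelerated_step:
  fixes x y w G :: "'a::real_inner" and t L \<mu> \<rho> Fz Fy Fw F' :: real
  assumes \<mu>: "0 < \<mu>" and L: "0 < L" and t: "1 \<le> t" and \<rho>: "\<rho> = \<mu> / (4 * L + 5 * \<mu>)"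
    and w: "Fz + G \<bullet> (w - x) + 3 / (8 * L) * (norm G)\<^sup>2 + \<mu> / 2 * (norm (w - x))\<^sup>2 \<le> Fw"
    and y: "(t - 1) * (Fz + G \<bullet> (y - x) + 3 / (8 * L) * (norm G)\<^sup>2 + \<mu> / 2 * (norm (y - x))\<^sup>2)
      \<le> (t - 1) * Fy"
    and F': "F' \<le> Fz"
  defines "r \<equiv> x + (t - 1) *\<^sub>R (x - y) - w"
  shows "(1 + \<rho>) * (t\<^sup>2 * (F' - Fw) + L * (norm (r - (t / (2 * L)) *\<^sub>R G))\<^sup>2)
    \<le> t * (t - 1) * (Fy - Fw) + L * (norm r)\<^sup>2"
proof -
  define p q where "p = x - w" and "q = x - y"
  have r: "r = p + (t - 1) *\<^sub>R q" by (simp add: r_def p_def q_def)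
  define c where "c = 3 / (8 * L) * (norm G)\<^sup>2"
  have w': "Fz - Fw \<le> G \<bullet> p - c - \<mu> / 2 * (p \<bullet> p)"
    using w[folded c_def] by (simp add: p_def power2_norm_eq_inner inner_simps inner_commute algebra_simps)
  have "(t - 1) * (Fz - Fy) \<le> (t - 1) * (G \<bullet> q - c - \<mu> / 2 * (q \<bullet> q))"
    using y[folded c_def] by (simp add: q_def power2_norm_eq_inner inner_simps inner_commute algebra_simps)
  with w' have "Fz - Fw + (t - 1) * (Fz - Fy)
     \<le> G \<bullet> r - t * (c) - \<mu> / 2 * (p \<bullet> p + (t - 1) * (q \<bullet> q))"
    by (simp add: r inner_simps field_simps)
  then have "t * (Fz - Fw + (t - 1) * (Fz - Fy))
     \<le> t * (G \<bullet> r - t * (c) - \<mu> / 2 * (p \<bullet> p + (t - 1) * (q \<bullet> q)))"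
    using t by (intro mult_left_mono) auto
  then have gap: "t\<^sup>2 * (Fz - Fw) - t * (t - 1) * (Fy - Fw)
     \<le> t * (G \<bullet> r) - t\<^sup>2 * (c) - \<mu> / 2 * (t * (p \<bullet> p + (t - 1) * (q \<bullet> q)))"
    by (simp add: power2_eq_square algebra_simps)
  \<comment> \<open>Convexity of the square: r / t is the convex combination of \<open>p\<close> and
    \<open>q\<close> with weights 1/t and (t - 1)/t.\<close>
  have "0 \<le> (t - 1) * ((p - q) \<bullet> (p - q))" using t by simp
  also have "\<dots> = t * (p \<bullet> p + (t - 1) * (q \<bullet> q)) - r \<bullet> r"
    by (simp add: r inner_simps inner_commute algebra_simps)
  finally have "\<mu> / 2 * (r \<bullet> r) \<le> \<mu> / 2 * (t * (p \<bullet> p + (t - 1) * (q \<bullet> q)))"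
    using \<mu> by (intro mult_left_mono) auto
  with gap have gap': "t\<^sup>2 * (Fz - Fw)
     \<le> t * (t - 1) * (Fy - Fw) + t * (G \<bullet> r) - t\<^sup>2 * c - \<mu> / 2 * (r \<bullet> r)"
    by (simp add: algebra_simps)
  have nr: "L * (norm (r - (t / (2 * L)) *\<^sub>R G))\<^sup>2 = L * (r \<bullet> r) - t * (G \<bullet> r) + 1 / (4 * L) * (t\<^sup>2 * (G \<bullet> G))"
    unfolding power2_norm_eq_inner using L
    by (simp add: inner_simps inner_commute power2_eq_square field_simps)
  \<comment> \<open>Completing the square bounds G . p - \<mu>/2 |p|^2 by |G|^2 / (2\<mu>), a
    Polyak-Lojasiewicz type estimate for the gap.\<close>
  have "0 \<le> ((1 / \<mu>) *\<^sub>R G - p) \<bullet> ((1 / \<mu>) *\<^sub>R G - p) * (\<mu> / 2)" using \<mu> by simp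
  also have "\<dots> = 1 / (2 * \<mu>) * (G \<bullet> G) - G \<bullet> p + \<mu> / 2 * (p \<bullet> p)"
    using \<mu> by (simp add: inner_simps inner_commute field_simps)
  finally have "Fz - Fw \<le> (1 / (2 * \<mu>) - 3 / (8 * L)) * (G \<bullet> G)"
    using w' by (simp add: c_def power2_norm_eq_inner algebra_simps)
  then have "t\<^sup>2 * (Fz - Fw) \<le> t\<^sup>2 * ((1 / (2 * \<mu>) - 3 / (8 * L)) * (G \<bullet> G))"
    by (intro mult_left_mono) auto
  then have PL: "t\<^sup>2 * (Fz - Fw) \<le> (1 / (2 * \<mu>) - 3 / (8 * L)) * (t\<^sup>2 * (G \<bullet> G))"
    by (simp add: algebra_simps)
  define E where "E = t\<^sup>2 * (Fz - Fw) + L * (norm (r - (t / (2 * L)) *\<^sub>R G))\<^sup>2"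
  have E1: "E \<le> t * (t - 1) * (Fy - Fw) + L * (r \<bullet> r)
      - (1 / (8 * L) * (t\<^sup>2 * (G \<bullet> G)) + \<mu> / 2 * (r \<bullet> r))"
  proof -
    \<comment> \<open>The 1/(4L) part cancels the square produced by \<open>nr\<close>; the 1/(8L)
      part is the surplus.\<close>
    have "t\<^sup>2 * c = 1 / (4 * L) * (t\<^sup>2 * (G \<bullet> G)) + 1 / (8 * L) * (t\<^sup>2 * (G \<bullet> G))"
      using L by (simp add: c_def power2_norm_eq_inner field_simps)
    with gap' show ?thesis unfolding E_def nr by linarith
  qed
  \<comment> \<open>The nonnegative square absorbs the cross term of \<open>nr\<close>. The two
    added terms enlarge the bound on \<open>E\<close> so that its coefficients of t^2 |G|^2 and
    |r|^2 are the surplus coefficients 1/(8L) and \<mu>/2, both divided by \<rho>.\<close>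
  have "0 \<le> ((t / (2 * L)) *\<^sub>R G + r) \<bullet> ((t / (2 * L)) *\<^sub>R G + r) * L
      + 1 / (2 * L) * (t\<^sup>2 * (G \<bullet> G)) + 5 * \<mu> / 2 * (r \<bullet> r)"
    using L \<mu> by simp
  also have "\<dots> = (1 / (2 * \<mu>) + 5 / (8 * L)) * (t\<^sup>2 * (G \<bullet> G)) + (2 * L + 5 * \<mu> / 2) * (r \<bullet> r)
     - ((1 / (2 * \<mu>) - 3 / (8 * L)) * (t\<^sup>2 * (G \<bullet> G)) + (L * (r \<bullet> r) - t * (G \<bullet> r) + 1 / (4 * L) * (t\<^sup>2 * (G \<bullet> G))))"
    using L \<mu> by (simp add: inner_simps inner_commute power2_eq_square field_simps)
  also have "\<dots> \<le> (1 / (2 * \<mu>) + 5 / (8 * L)) * (t\<^sup>2 * (G \<bullet> G)) + (2 * L + 5 * \<mu> / 2) * (r \<bullet> r) - E"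
    unfolding E_def nr using PL by simp
  finally have "E \<le> (1 / (2 * \<mu>) + 5 / (8 * L)) * (t\<^sup>2 * (G \<bullet> G)) + (2 * L + 5 * \<mu> / 2) * (r \<bullet> r)"
    by simp
  then have "\<rho> * E \<le> \<rho> * ((1 / (2 * \<mu>) + 5 / (8 * L)) * (t\<^sup>2 * (G \<bullet> G)) + (2 * L + 5 * \<mu> / 2) * (r \<bullet> r))"
    using \<mu> L by (intro mult_left_mono) (auto simp: \<rho>)
  also have "\<dots> = \<rho> * (1 / (2 * \<mu>) + 5 / (8 * L)) * (t\<^sup>2 * (G \<bullet> G)) + \<rho> * (2 * L + 5 * \<mu> / 2) * (r \<bullet> r)"
    by (simp only: distrib_left[of _ "_ * (t\<^sup>2 * (G \<bullet> G))"] mult.assoc)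
  also have "\<rho> * (1 / (2 * \<mu>) + 5 / (8 * L)) = 1 / (8 * L)"
  proof -
    have "1 / (2 * \<mu>) + 5 / (8 * L) = (4 * L + 5 * \<mu>) / (8 * L * \<mu>)"
      using \<mu> L by (simp add: field_simps)
    moreover have "4 * L + 5 * \<mu> \<noteq> 0" using \<mu> L by simp
    ultimately show ?thesis using \<mu> L by (simp add: \<rho>)
  qed
  also have "\<rho> * (2 * L + 5 * \<mu> / 2) = \<mu> / 2"
  proof -
    have "4 * L + 5 * \<mu> > 0" using \<mu> L by simp
    then show ?thesis by (simp add: \<rho> divide_simps)
  qed
  finally have "(1 + \<rho>) * E \<le> t * (t - 1) * (Fy - Fw) + L * (norm r)\<^sup>2"
    using E1 by (simp add: power2_norm_eq_inner algebra_simps)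
  moreover have "(1 + \<rho>) * (t\<^sup>2 * (F' - Fw) + L * (norm (r - (t / (2 * L)) *\<^sub>R G))\<^sup>2) \<le> (1 + \<rho>) * E"
    unfolding E_def using F' \<mu> L
    by (intro mult_left_mono add_right_mono) (auto simp: \<rho>)
  ultimately show ?thesis by linarith
qed

section \<open>Riesz representation and gradients\<close>

text \<open>
  The representing vector is the minimizer of \<open>\<parallel>u\<parallel>\<^sup>2 / 2 - h u\<close>, i.e. the proximal point of \<open>-h\<close> at \<open>0\<close>.
\<close>

lemma Riesz_representation:
  fixes h :: "'a::{real_inner, complete_space} \<Rightarrow> real"
  assumes "bounded_linear h"
  shows "\<exists>w. \<forall>u. h u = u \<bullet> w"
proof -
  interpret h: bounded_linear h by fact
  define g where "g u = ereal (- h u)" for u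
  have "convex_fun g"
    by (simp add: convex_fun_def g_def h.add h.scale)
  moreover have "lsc_fun g"
    unfolding lsc_fun_def le_Liminf_iff
  proof (intro allI impI)
    fix u y assume "y < g u"
    moreover have "(g \<longlongrightarrow> g u) (at u)"
      unfolding g_def by (intro tendsto_intros h.tendsto)
    ultimately show "\<forall>\<^sub>F v in at u. y < g v"
      by (metis order_tendstoD(1))
  qed
  moreover obtain K where "\<And>u. norm (h u) \<le> norm u * K"
    using h.bounded by blast
  then have "ereal (- 0 - K * norm u) \<le> g u" for u
    by (simp add: g_def mult.commute) (meson abs_ge_self order_trans)
  moreover have "g 0 \<noteq> \<infinity>" by (simp add: g_def)
  ultimately obtain w where
    w: "is_arg_min (\<lambda>u. g u + ereal (1 / (2 * 1) * (norm (u - 0))\<^sup>2)) (\<lambda>_. True) w"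
    using proximal_minimizer_exists[of g 1 0 K 0 0] by auto
  \<comment> \<open>Optimality makes -w a subgradient of -h at \<open>w\<close>; using the
    inequality for \<open>d\<close> and for -d gives equality.\<close>
  have le: "h d \<le> w \<bullet> d" for d
    using prox_tangent_bound[OF \<open>convex_fun g\<close> _ _ w, of "- h w" "w + d"]
    by (simp add: g_def h.add)
  have "h d = d \<bullet> w" for d
    using le[of d] le[of "- d"] by (simp add: h.neg inner_commute)
  then show ?thesis by blast
qed

lemma GDERIV_gradient:
  fixes f :: "'a::{real_inner, complete_space} \<Rightarrow> real"
  assumes "f differentiable (at x)"
  shows "GDERIV f x :> gradient f x"
proof -
  obtain f' where f': "(f has_derivative f') (at x)"
    using assms by (auto simp: differentiable_def)
  obtain D where "\<And>u. f' u = u \<bullet> D"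
    using Riesz_representation[OF has_derivative_bounded_linear[OF f']] by blast
  then have D: "GDERIV f x :> D"
    using f' unfolding gderiv_def by (metis has_derivative_eq_rhs ext)
  have "D' = D" if "GDERIV f x :> D'" for D'
  proof -
    have "(\<lambda>u. u \<bullet> D') = (\<lambda>u. u \<bullet> D)"
      using that D unfolding gderiv_def by (rule has_derivative_unique)
    then show ?thesis by (metis vector_eq_ldot)
  qed
  with D show ?thesis
    unfolding gradient_def by (rule theI)
qed

section \<open>Proximal gradient inequality\<close>

text \<open>Three bounds are added: G - D x is a subgradient of \<open>g\<close> at
  \<open>w\<close>, strong convexity bounds f u from \<open>x\<close>, and the descent lemma bounds
  f w from \<open>x\<close>. Moving the base point from \<open>w\<close> to \<open>x\<close> gains
  |G|^2 / (2L) and descent costs |G|^2 / (8L), whence 3/(8L).\<close>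

lemma proximal_gradient_bound:
  fixes f :: "'a::{real_inner, complete_space} \<Rightarrow> real"
  assumes L: "0 < L" and grad: "\<And>x. GDERIV f x :> D x" and lip: "L-lipschitz_on UNIV D"
    and sc: "strongly_convex_fun \<mu> f" and g: "convex_fun g"
    and w: "is_arg_min (\<lambda>u. g u + ereal (1 / (2 * s) * (norm (u - (x - s *\<^sub>R D x)))\<^sup>2)) (\<lambda>_. True) w"
    and s: "s = 1 / (2 * L)"
    and r: "g w = ereal r" and q: "g u = ereal q"
  defines "G \<equiv> (2 * L) *\<^sub>R (x - w)"
  shows "f w + r + G \<bullet> (u - x) + 3 / (8 * L) * (norm G)\<^sup>2 + \<mu> / 2 * (norm (u - x))\<^sup>2 \<le> f u + q"
proof -
  have "0 < s" using L s by simp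
  have "(x - s *\<^sub>R D x - w) /\<^sub>R s = G - D x"
    using L by (simp add: G_def s scaleR_diff_right)
  then have "r + (G - D x) \<bullet> (u - w) \<le> q"
    using prox_tangent_bound[OF g r \<open>0 < s\<close> w, of u] by (simp add: q)
  moreover have "f x + D x \<bullet> (u - x) + \<mu> / 2 * (norm (u - x))\<^sup>2 \<le> f u"
    using grad sc by (rule strongly_convex_tangent)
  moreover have "f w \<le> f x + D x \<bullet> (w - x) + L / 2 * (norm (w - x))\<^sup>2"
    using grad lip by (rule descent_lemma)
  moreover have "L / 2 * (norm (w - x))\<^sup>2 = 1 / (8 * L) * (norm G)\<^sup>2"
    unfolding G_def norm_scaleR using L
    by (simp add: norm_minus_commute[of w] power2_eq_square field_simps del: scaleR_diff_right)
  moreover have "G \<bullet> (u - w) = G \<bullet> (u - x) + 1 / (2 * L) * (norm G)\<^sup>2"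
  proof -
    have "u - w = (u - x) + (1 / (2 * L)) *\<^sub>R G" using L by (simp add: G_def)
    then show ?thesis
      by (simp only: inner_add_right inner_scaleR_right power2_norm_eq_inner)
  qed
  moreover have "3 / (8 * L) * (norm G)\<^sup>2 = 1 / (2 * L) * (norm G)\<^sup>2 - 1 / (8 * L) * (norm G)\<^sup>2"
    using L by (simp add: field_simps)
  ultimately show ?thesis
    by (simp only: inner_diff_left inner_diff_right)
qed

section \<open>The extrapolation weights\<close>

lemma tseq_ge_1: "1 \<le> tseq k"
proof (cases k)
  case (Suc j)
  have "1 \<le> sqrt (1 + 4 * (tseq j)\<^sup>2)" by simp
  then show ?thesis by (simp add: Suc)
qed simp

text \<open>This identity turns the weight t^2 produced by one step into the weight of the next
  Lyapunov value.\<close>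

lemma tseq_Suc: "tseq (Suc k) * (tseq (Suc k) - 1) = (tseq k)\<^sup>2"
proof -
  have "(sqrt (1 + 4 * (tseq k)\<^sup>2))\<^sup>2 = 1 + 4 * (tseq k)\<^sup>2"
    by (intro real_sqrt_pow2) simp
  then show ?thesis
    by (simp add: power2_eq_square field_simps)
qed

section \<open>Convergence of the iteration\<close>

theorem corollary8:
  fixes f :: "'a::{real_inner, complete_space} \<Rightarrow> real"
    and g :: "'a \<Rightarrow> ereal"
    and x y z :: "nat \<Rightarrow> 'a"
    and xstar :: 'a
    and L \<mu> \<rho> :: real
    and k :: nat
  assumes "0 < \<mu>" and "\<mu> \<le> L"
    and "strongly_convex_fun \<mu> f" and "smooth_fun L f"
    and "convex_fun g" and "proper_fun g" and "lsc_fun g"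
    and "is_arg_min (composite f g) (\<lambda>_. True) xstar"
    and "m_apm (1 / (2 * L)) 1 f g x y z"
    and "\<rho> = \<mu> / (4 * L + 5 * \<mu>)"
    and "k \<ge> 2"
  shows "composite f g (y k) - composite f g xstar
    \<le> ereal (L * (norm (x 0 - xstar))\<^sup>2 / (tseq k * (tseq k - 1)) * (1 + \<rho>) powi (- int k + 2))"
proof -
  have L: "0 < L" using assms(1,2) by simp
  have \<rho>: "0 < \<rho>" using assms(1,10) L by simp
  define s where "s = 1 / (2 * L)"
  have s: "0 < s" using L by (simp add: s_def)
  have grad: "GDERIV f v :> gradient f v" for v
    using assms(4) by (simp add: smooth_fun_def GDERIV_gradient)
  have lip: "L-lipschitz_on UNIV (gradient f)"
    using assms(4) by (simp add: smooth_fun_def)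
  have g_not_minf: "g u \<noteq> -\<infinity>" for u
    using assms(6) by (simp add: proper_fun_def)
  have opt: "composite f g xstar \<le> composite f g u" for u
    using assms(8) by (simp add: is_arg_min_def not_less)
  obtain u0 where "g u0 \<noteq> \<infinity>"
    using assms(6) by (auto simp: proper_fun_def)
  with opt[of u0] have "g xstar \<noteq> \<infinity>"
    by (auto simp: composite_def)
  with g_not_minf obtain r where r: "g xstar = ereal r"
    by (cases "g xstar") auto
  define Fw where "Fw = f xstar + r"
  have Fw: "composite f g xstar = ereal Fw"
    by (simp add: composite_def Fw_def r)

  \<comment> \<open>The lower bound required for proximal points comes from the minimizer: minus the
    gradient of \<open>f\<close> at \<open>xstar\<close> is a subgradient of \<open>g\<close>
    there.\<close>
  have "ereal (r - gradient f xstar \<bullet> (u - xstar)) \<le> g u" for u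
    using assms(5) r descent_lemma[OF grad lip, of _ xstar]
  proof (rule minimizer_tangent_bound)
    show "g xstar + ereal (f xstar) \<le> g u + ereal (f u)" for u
      using opt[of u] by (simp add: composite_def add.commute)
  qed
  moreover have "- (- (r + gradient f xstar \<bullet> xstar)) - norm (gradient f xstar) * norm u
      \<le> r - gradient f xstar \<bullet> (u - xstar)" for u
    using norm_cauchy_schwarz[of "gradient f xstar" u] by (simp add: inner_diff_right)
  ultimately have lower: "ereal (- (- (r + gradient f xstar \<bullet> xstar)) - norm (gradient f xstar) * norm u) \<le> g u" for u
    using order_trans ereal_less_eq(3) by blast

  \<comment> \<open>\<open>ARG_MIN\<close> is a choice operator, so \<open>prox\<close> minimizes
    only once existence is known.\<close>
  have prox: "is_arg_min (\<lambda>u. g u + ereal (1 / (2 * s) * (norm (u - v))\<^sup>2)) (\<lambda>_. True) (prox s g v)" for v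
    unfolding prox_def arg_min_def
    by (rule someI_ex, rule proximal_minimizer_exists[OF assms(5,7) s lower \<open>g u0 \<noteq> \<infinity>\<close>])

  have z: "z k = prox s g (x k - s *\<^sub>R gradient f (x k))"
    and y: "y (Suc k) = (if composite f g (z k) \<le> composite f g (y k) then z k else y k)"
    and x: "x (Suc k) = y (Suc k)
           + ((tseq k - 1) / tseq (Suc k)) *\<^sub>R (y (Suc k) - y k)
           + (tseq k / tseq (Suc k)) *\<^sub>R (z k - y (Suc k))" for k
    using assms(9) unfolding m_apm_def s_def[symmetric] by auto
  have zmin: "is_arg_min (\<lambda>u. g u + ereal (1 / (2 * s) * (norm (u - (x k - s *\<^sub>R gradient f (x k))))\<^sup>2)) (\<lambda>_. True) (z k)" for k
    unfolding z by (rule prox)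
  have "g (z k) \<noteq> \<infinity>" for k
  proof
    assume "g (z k) = \<infinity>"
    moreover have "\<not> g xstar + ereal (1 / (2 * s) * (norm (xstar - (x k - s *\<^sub>R gradient f (x k))))\<^sup>2)
       < g (z k) + ereal (1 / (2 * s) * (norm (z k - (x k - s *\<^sub>R gradient f (x k))))\<^sup>2)"
      using zmin[of k] by (auto simp: is_arg_min_def)
    ultimately show False by (simp add: r)
  qed
  then have gz: "g (z k) = ereal (real_of_ereal (g (z k)))" for k
    using g_not_minf[of "z k"] by (cases "g (z k)") auto
  define Fz where "Fz k = f (z k) + real_of_ereal (g (z k))" for k
  \<comment> \<open>If \<open>F(y\<^sub>0) = \<infinity>\<close>, then \<open>Fy 0\<close> is a junk value; it only occurs with the weight \<open>t\<^sub>0 - 1 = 0\<close>.\<close>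
  define Fy where "Fy k = real_of_ereal (composite f g (y k))" for k
  have Fz: "composite f g (z k) = ereal (Fz k)" for k
    unfolding composite_def Fz_def by (subst gz) simp
  have y_le: "composite f g (y (Suc k)) \<le> ereal (Fz k)" for k
    using y[of k] Fz[of k] by (auto simp: not_le)
  have Fy: "composite f g (y (Suc k)) = ereal (Fy (Suc k))" for k
  proof -
    have "composite f g (y (Suc k)) \<noteq> \<infinity>" "composite f g (y (Suc k)) \<noteq> -\<infinity>"
      using y_le[of k] opt[of "y (Suc k)"] Fw by auto
    then show ?thesis unfolding Fy_def by (cases "composite f g (y (Suc k))") auto
  qed
  define G where "G k = (2 * L) *\<^sub>R (x k - z k)" for k
  have key: "Fz k + G k \<bullet> (u - x k) + 3 / (8 * L) * (norm (G k))\<^sup>2 + \<mu> / 2 * (norm (u - x k))\<^sup>2 \<le> c"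
    if c: "composite f g u = ereal c" for k u c
  proof -
    obtain q where q: "g u = ereal q"
      using c g_not_minf[of u] by (cases "g u") (auto simp: composite_def)
    have "c = f u + q" using c by (simp add: composite_def q)
    then show ?thesis
      unfolding Fz_def G_def
      using proximal_gradient_bound[OF L grad lip assms(3,5) zmin[of k] s_def gz q] by simp
  qed

  define U where "U k = x k + (tseq k - 1) *\<^sub>R (x k - y k) - xstar" for k
  define E where "E k = tseq k * (tseq k - 1) * (Fy k - Fw) + L * (norm (U k))\<^sup>2" for k
  \<comment> \<open>The coefficients of y (Suc k) sum to zero, leaving t z - (t - 1) y - xstar
    whichever branch of the monotone test was taken.\<close>
  have U_Suc: "U (Suc k) = U k - (tseq k / (2 * L)) *\<^sub>R G k" for k
  proof -
    have t: "tseq (Suc k) \<noteq> 0" using tseq_ge_1[of "Suc k"] by linarith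
    have "tseq (Suc k) *\<^sub>R (x (Suc k) - y (Suc k))
        = (tseq k - 1) *\<^sub>R (y (Suc k) - y k) + tseq k *\<^sub>R (z k - y (Suc k))"
      unfolding x[of k] using t by (simp add: scaleR_add_right del: tseq.simps)
    moreover have "U (Suc k) = y (Suc k) + tseq (Suc k) *\<^sub>R (x (Suc k) - y (Suc k)) - xstar"
      by (simp add: U_def algebra_simps del: tseq.simps)
    ultimately show ?thesis
      using L by (simp add: U_def G_def algebra_simps del: tseq.simps)
  qed
  have step: "(1 + \<rho>) * E (Suc k) \<le> E k" for k
  proof -
    have "(tseq k - 1) * (Fz k + G k \<bullet> (y k - x k) + 3 / (8 * L) * (norm (G k))\<^sup>2 + \<mu> / 2 * (norm (y k - x k))\<^sup>2)
        \<le> (tseq k - 1) * Fy k"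
    proof (cases k)
      case (Suc j)
      with key[OF Fy[of j], of k] tseq_ge_1[of k] show ?thesis
        by (intro mult_left_mono) (auto simp del: tseq.simps)
    qed simp
    moreover have "Fy (Suc k) \<le> Fz k" using y_le[of k] Fy[of k] by simp
    ultimately show ?thesis
      unfolding E_def tseq_Suc U_Suc unfolding U_def
      using accelerated_step[OF assms(1) L tseq_ge_1 assms(10) key[OF Fw]] by blast
  qed
  have E: "(1 + \<rho>) ^ k * E k \<le> L * (norm (x 0 - xstar))\<^sup>2" for k
  proof (induction k)
    case 0
    show ?case by (simp add: E_def U_def)
  next
    case (Suc k)
    have "(1 + \<rho>) ^ k * ((1 + \<rho>) * E (Suc k)) \<le> (1 + \<rho>) ^ k * E k"
      using step \<rho> by (intro mult_left_mono) auto
    with Suc show ?case by (simp add: mult_ac)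
  qed

  define T where "T = tseq k * (tseq k - 1)"
  define N where "N = L * (norm (x 0 - xstar))\<^sup>2"
  obtain j where j: "k = Suc (Suc j)"
    using assms(11) by (metis add_2_eq_Suc le_Suc_ex)
  have T: "0 < T"
    using tseq_ge_1[of "Suc j"] unfolding T_def j tseq_Suc by (simp del: tseq.simps)
  \<comment> \<open>The Lyapunov estimate carries the exponent \<open>k\<close>; for a nonnegative
    gap it is weakened to j = k - 2, and for a negative one the signs suffice.\<close>
  have "(1 + \<rho>) ^ j * (T * (Fy k - Fw)) \<le> N"
  proof (cases "0 \<le> Fy k - Fw")
    case True
    have "T * (Fy k - Fw) \<le> E k" using L by (simp add: E_def T_def)
    then have "(1 + \<rho>) ^ k * (T * (Fy k - Fw)) \<le> N"
      using E[of k] \<rho> unfolding N_def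
      by (meson add_pos_pos less_imp_le mult_left_mono order_trans zero_less_one zero_less_power)
    moreover have "(1 + \<rho>) ^ j * (T * (Fy k - Fw)) \<le> (1 + \<rho>) ^ k * (T * (Fy k - Fw))"
      using True T \<rho> by (intro mult_right_mono power_increasing) (auto simp: j)
    ultimately show ?thesis by simp
  next
    case False
    then have "(1 + \<rho>) ^ j * (T * (Fy k - Fw)) \<le> 0"
      using T \<rho> by (simp add: mult_le_0_iff)
    also have "0 \<le> N" using L by (simp add: N_def)
    finally show ?thesis .
  qed
  then have "Fy k - Fw \<le> N / T * inverse ((1 + \<rho>) ^ j)"
    using T \<rho> by (simp add: field_simps)
  also have "inverse ((1 + \<rho>) ^ j) = (1 + \<rho>) powi (- int k + 2)"
    by (simp add: j power_int_minus)
  finally have "Fy k - Fw \<le> N / T * (1 + \<rho>) powi (- int k + 2)" .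
  then show ?thesis
    using Fy[of "Suc j"] by (simp add: Fw N_def T_def j del: tseq.simps)
qed

end
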